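(* Let $n,q\ge 1$ be integers and let $F$ be any graph. If $H\subseteq Q(n,2)$ does not contain a $(q+1)$-copy of $F$, then $$|H|\le \left(q^2-\left(q-\left\lceil \tfrac{q+1}{2}\right\rceil +1\right)^2\right)\binom{n}{2}+\left(q-\left\lceil \tfrac{q+1}{2}\right\rceil +1\right)^2\mathrm{ex}(n,F).$$
   Context: All graphs are finite and simple; $\mathrm{ex}(n,F)$ is the ordinary Turán number, the maximum number of edges of an $n$-vertex graph with no subgraph isomorphic to $F$. For $\mathbf{x}\in\{0,1,\dots,q\}^n$ the support is $S_{\mathbf{x}}=\{i: x_i\neq 0\}$. Let $Q(n,2)=\{\mathbf{x}\in\{0,1,\dots,q\}^n: |S_{\mathbf{x}}|=2\}$; its elements are called $q$-edges, and a $q$-graph on $n$ vertices is a subset $H\subseteq Q(n,2)$. For a graph $F$ without isolated vertices and an integer $s\ge1$, a $q$-graph $H$ is an $s$-copy of $F$ if $|H|=|E(F)|$ and there is an isomorphism $\iota$ from $F$ to the graph with vertex set $\bigcup_{\mathbf{x}\in H}S_{\mathbf{x}}$ and edge set $\{S_{\mathbf{x}}:\mathbf{x}\in H\}$ such that, writing $\mathbf{x}^e$ for the unique element of $H$ with support $\iota(e)$, for all distinct $e,e'\in E(F)$ and $v\in e\cap e'$ we have $x^{e}_{\iota(v)}+x^{e'}_{\iota(v)}\ge s$. If $F$ has isolated vertices, $H\subseteq Q(n,2)$ is an $s$-copy of $F$ if $n\ge |V(F)|$ and $H$ is an $s$-copy of the subgraph of $F$ induced by its non-isolated vertices. A $q$-graph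 contains an $s$-copy of $F$ if some subset of it is an $s$-copy of $F$. *)

theory Defs
  imports Complex_Main "HOL-Library.FuncSet"
begin

type_synonym 'a ugraph = "'a set \<times> 'a set set"

abbreviation (input) verts :: "'a ugraph \<Rightarrow> 'a set" where "verts G \<equiv> fst G"
abbreviation (input) edges :: "'a ugraph \<Rightarrow> 'a set set" where "edges G \<equiv> snd G"

definition simple_graph :: "'a ugraph \<Rightarrow> bool" where
  "simple_graph G \<longleftrightarrow> finite (verts G) \<and> (\<forall>e\<in>edges G. e \<subseteq> verts G \<and> card e = 2)"

definition graph_iso :: "('a \<Rightarrow> 'b) \<Rightarrow> 'a ugraph \<Rightarrow> 'b ugraph \<Rightarrow> bool" where
  "graph_iso \<iota> F G \<longleftrightarrow> bij_betw \<iota> (verts F) (verts G) \<and>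
     (\<forall>u\<in>verts F. \<forall>v\<in>verts F. {u, v} \<in> edges F \<longleftrightarrow> {\<iota> u, \<iota> v} \<in> edges G)"

definition subgraph :: "'a ugraph \<Rightarrow> 'a ugraph \<Rightarrow> bool" where
  "subgraph G' G \<longleftrightarrow> simple_graph G' \<and> verts G' \<subseteq> verts G \<and> edges G' \<subseteq> edges G"

definition contains_graph :: "'b ugraph \<Rightarrow> 'a ugraph \<Rightarrow> bool" where
  "contains_graph G F \<longleftrightarrow> (\<exists>G' \<iota>. subgraph G' G \<and> graph_iso \<iota> F G')"

text \<open>Every finite graph is isomorphic to one with natural-number vertices, so only those are
  considered. If \<open>F\<close> has no edges and at most \<open>n\<close> vertices, no \<open>n\<close>-vertex graph avoids \<open>F\<close> and
  the value is unspecified.\<close>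

definition ex_number :: "nat \<Rightarrow> 'a ugraph \<Rightarrow> nat" where
  "ex_number n F = Max {card (edges G) | G :: nat ugraph.
     simple_graph G \<and> card (verts G) = n \<and> \<not> contains_graph G F}"

definition isolated :: "'a ugraph \<Rightarrow> 'a set" where
  "isolated G = {v \<in> verts G. \<forall>e\<in>edges G. v \<notin> e}"

definition induced :: "'a ugraph \<Rightarrow> 'a set \<Rightarrow> 'a ugraph" where
  "induced G W = (W, {e \<in> edges G. e \<subseteq> W})"

text \<open>Vectors of length \<open>n\<close> are extensional functions on \<open>{1..n}\<close>, so that equality of vectors is
  equality of functions.\<close>

definition supp :: "nat \<Rightarrow> (nat \<Rightarrow> nat) \<Rightarrow> nat set" where
  "supp n x = {i \<in> {1..n}. x i \<noteq> 0}"

definition q_edges :: "nat \<Rightarrow> nat \<Rightarrow> (nat \<Rightarrow> nat) set" where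
  "q_edges q n = {x \<in> {1..n} \<rightarrow>\<^sub>E {0..q}. card (supp n x) = 2}"

definition support_graph :: "nat \<Rightarrow> (nat \<Rightarrow> nat) set \<Rightarrow> nat ugraph" where
  "support_graph n H = (\<Union>x\<in>H. supp n x, supp n ` H)"

text \<open>The condition \<open>card H = card (edges F)\<close> together with the isomorphism makes \<open>supp n\<close>
  injective on \<open>H\<close>, so the definite description below is well-defined.\<close>

definition s_copy_no_isolated ::
  "nat \<Rightarrow> nat \<Rightarrow> nat \<Rightarrow> 'a ugraph \<Rightarrow> (nat \<Rightarrow> nat) set \<Rightarrow> bool" where
  "s_copy_no_isolated q n s F H \<longleftrightarrow> H \<subseteq> q_edges q n \<and> card H = card (edges F) \<and>
     (\<exists>\<iota>. graph_iso \<iota> F (support_graph n H) \<and>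
        (let X = (\<lambda>e. THE x. x \<in> H \<and> supp n x = \<iota> ` e) in
          \<forall>e\<in>edges F. \<forall>e'\<in>edges F. e \<noteq> e' \<longrightarrow>
            (\<forall>v\<in>e \<inter> e'. X e (\<iota> v) + X e' (\<iota> v) \<ge> s)))"

definition s_copy ::
  "nat \<Rightarrow> nat \<Rightarrow> nat \<Rightarrow> 'a ugraph \<Rightarrow> (nat \<Rightarrow> nat) set \<Rightarrow> bool" where
  "s_copy q n s F H \<longleftrightarrow>
     (if isolated F = {} then s_copy_no_isolated q n s F H
      else n \<ge> card (verts F) \<and> s_copy_no_isolated q n s (induced F (verts F - isolated F)) H)"

definition contains_s_copy ::
  "nat \<Rightarrow> nat \<Rightarrow> nat \<Rightarrow> 'a ugraph \<Rightarrow> (nat \<Rightarrow> nat) set \<Rightarrow> bool" where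
  "contains_s_copy q n s F H \<longleftrightarrow> (\<exists>H'\<subseteq>H. s_copy q n s F H')"

end

theory Submission
  imports Defs
begin

text \<open>
  Call a vector heavy when both of its nonzero entries are at least
  \<open>a = \<lceil>(q + 1) / 2\<rceil>\<close>. Two such entries always add up to at least \<open>q + 1\<close>, so the sum condition
  in the definition of a \<open>(q + 1)\<close>-copy is automatic for heavy vectors: if the graph \<open>G\<close> of the
  supports of the heavy members of \<open>H\<close> contained \<open>F\<close>, then choosing one heavy vector
  for each edge of that copy would give a \<open>(q + 1)\<close>-copy of \<open>F\<close> in \<open>H\<close>
  (\<open>contains_s_copy_of_contains_heavy_graph\<close>). Hence \<open>G\<close> has at most \<open>ex(n,F)\<close> edges.

  A pair of coordinates carries at most \<open>q\<^sup>2\<close> members of \<open>H\<close>, namely one for each choice of two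
  values in \<open>{1..q}\<close>. If it is not an edge of \<open>G\<close>, the \<open>m\<^sup>2\<close> choices with both values in \<open>{a..q}\<close>
  are excluded, where \<open>m = q - a + 1\<close>, so it carries at most \<open>q\<^sup>2 - m\<^sup>2\<close>
  (\<open>card_q_edges_on_pair_le\<close>, \<open>card_light_q_edges_on_pair_le\<close>). Summing over all pairs gives
  \<open>|H| \<le> (q\<^sup>2 - m\<^sup>2) (n choose 2) + m\<^sup>2 e(G)\<close>.
\<close>

definition heavy :: "nat \<Rightarrow> nat \<Rightarrow> (nat \<Rightarrow> nat) \<Rightarrow> bool" where
  "heavy n a x \<longleftrightarrow> (\<forall>i\<in>supp n x. a \<le> x i)"

definition heavy_graph :: "nat \<Rightarrow> nat \<Rightarrow> (nat \<Rightarrow> nat) set \<Rightarrow> nat ugraph" where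
  "heavy_graph n a H = ({1..n}, supp n ` {x \<in> H. heavy n a x})"

definition pairs :: "nat \<Rightarrow> nat set set" where
  "pairs n = {p. p \<subseteq> {1..n} \<and> card p = 2}"

lemma finite_pairs: "finite (pairs n)"
  unfolding pairs_def by simp

lemma card_pairs: "card (pairs n) = n choose 2"
  unfolding pairs_def using n_subsets[of "{1..n}" 2] by simp

lemma supp_in_pairs: "x \<in> q_edges q n \<Longrightarrow> supp n x \<in> pairs n"
  unfolding q_edges_def pairs_def supp_def by auto

lemma finite_q_edges: "finite (q_edges q n)"
proof -
  have "finite ({1..n} \<rightarrow>\<^sub>E {0..q})" by (rule finite_PiE) auto
  then show ?thesis
    unfolding q_edges_def by (rule rev_finite_subset) auto
qed

lemma simple_heavy_graph:
  assumes "H \<subseteq> q_edges q n"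
  shows "simple_graph (heavy_graph n a H)"
  using assms supp_in_pairs unfolding simple_graph_def heavy_graph_def pairs_def by fastforce


section \<open>Turan numbers\<close>

lemma finite_edge_counts:
  "finite {card (edges G) | G :: nat ugraph.
     simple_graph G \<and> card (verts G) = n \<and> \<not> contains_graph G F}"
proof (rule finite_subset)
  show "{card (edges G) | G :: nat ugraph.
     simple_graph G \<and> card (verts G) = n \<and> \<not> contains_graph G F} \<subseteq> {..2 ^ n}"
  proof
    fix k assume "k \<in> {card (edges G) | G :: nat ugraph.
     simple_graph G \<and> card (verts G) = n \<and> \<not> contains_graph G F}"
    then obtain G :: "nat ugraph"
      where k: "k = card (edges G)" and G: "simple_graph G" "card (verts G) = n"
      by auto
    have "edges G \<subseteq> Pow (verts G)" "finite (verts G)"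
      using G unfolding simple_graph_def by auto
    then have "card (edges G) \<le> card (Pow (verts G))"
      by (intro card_mono) auto
    then show "k \<in> {..2 ^ n}"
      using k G \<open>finite (verts G)\<close> by (simp add: card_Pow)
  qed
qed simp

lemma card_edges_le_ex_number:
  fixes G :: "nat ugraph"
  assumes "simple_graph G" "card (verts G) = n" "\<not> contains_graph G F"
  shows "card (edges G) \<le> ex_number n F"
  unfolding ex_number_def using assms by (intro Max_ge finite_edge_counts) blast


section \<open>Copies among heavy vectors\<close>

text \<open>The subgraph of \<open>F\<close> induced by its non-isolated vertices is \<open>F\<close> itself when nothing is
  isolated, so both branches of the definition of an \<open>s\<close>-copy are instances of one criterion.\<close>

lemma s_copyI:
  assumes "simple_graph F" "card (verts F) \<le> n"
    and "s_copy_no_isolated q n s (induced F (verts F - isolated F)) H"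
  shows "s_copy q n s F H"
proof -
  have "induced F (verts F) = F"
    using assms(1) unfolding induced_def simple_graph_def by (cases F) auto
  then show ?thesis
    using assms(2,3) unfolding s_copy_def by auto
qed

lemma induced_non_isolated:
  assumes "simple_graph F"
  shows "induced F (verts F - isolated F) = (\<Union>(edges F), edges F)"
  using assms unfolding induced_def isolated_def simple_graph_def by fastforce

lemma contains_s_copy_of_contains_heavy_graph:
  assumes F: "simple_graph F" and H: "H \<subseteq> q_edges q n" and a: "s \<le> 2 * a"
    and F_in_G: "contains_graph (heavy_graph n a H) F"
  shows "contains_s_copy q n s F H"
proof -
  obtain G' \<iota> where G': "subgraph G' (heavy_graph n a H)" and iso: "graph_iso \<iota> F G'"
    using F_in_G unfolding contains_graph_def by blast
  have bij: "bij_betw \<iota> (verts F) (verts G')"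
    using iso unfolding graph_iso_def by blast
  then have inj: "inj_on \<iota> (verts F)" by (rule bij_betw_imp_inj_on)
  have "verts G' \<subseteq> {1..n}"
    using G' unfolding subgraph_def heavy_graph_def by simp
  then have "card (verts G') \<le> n"
    using card_mono[of "{1..n}" "verts G'"] by simp
  then have card_F: "card (verts F) \<le> n"
    using bij_betw_same_card[OF bij] by simp
  have edge_sub: "e \<subseteq> verts F" if "e \<in> edges F" for e
    using F that unfolding simple_graph_def by blast
  have edge_inj: "e = e'" if "e \<in> edges F" "e' \<in> edges F" "\<iota> ` e = \<iota> ` e'" for e e'
    using inj_on_image_eq_iff[OF inj] edge_sub that by blast
  have image_edge: "\<iota> ` e \<in> edges G'" if e: "e \<in> edges F" for e
  proof -
    obtain u v where "e = {u, v}"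
      using F e unfolding simple_graph_def by (meson card_2_iff)
    then show ?thesis
      using iso e edge_sub[OF e] unfolding graph_iso_def by auto
  qed
  have "\<exists>x\<in>H. heavy n a x \<and> supp n x = \<iota> ` e" if "e \<in> edges F" for e
  proof -
    have "\<iota> ` e \<in> supp n ` {x \<in> H. heavy n a x}"
      using image_edge[OF that] G' unfolding subgraph_def heavy_graph_def by auto
    then show ?thesis by (elim imageE) auto
  qed
  then obtain X where X: "X e \<in> H" "heavy n a (X e)" "supp n (X e) = \<iota> ` e"
    if "e \<in> edges F" for e
    by metis
  have X_inj: "inj_on X (edges F)"
    using X(3) edge_inj by (metis inj_onI)
  let ?K = "X ` edges F"
  have K_the: "(THE x. x \<in> ?K \<and> supp n x = \<iota> ` e) = X e" if "e \<in> edges F" for e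
  proof (rule the_equality)
    show "X e \<in> ?K \<and> supp n (X e) = \<iota> ` e" using X that by blast
    show "x = X e" if "x \<in> ?K \<and> supp n x = \<iota> ` e" for x
      using that X(3) edge_inj \<open>e \<in> edges F\<close> by (metis imageE)
  qed
  have K_graph: "support_graph n ?K = (\<iota> ` \<Union>(edges F), (`) \<iota> ` edges F)"
    unfolding support_graph_def using X(3) by (auto simp: image_iff)
  have "bij_betw \<iota> (\<Union>(edges F)) (\<iota> ` \<Union>(edges F))"
    using inj edge_sub by (meson Union_least inj_on_imp_bij_betw inj_on_subset)
  moreover have "{u, v} \<in> edges F \<longleftrightarrow> {\<iota> u, \<iota> v} \<in> (`) \<iota> ` edges F"
    if uv: "u \<in> \<Union>(edges F)" "v \<in> \<Union>(edges F)" for u v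
  proof
    assume "{u, v} \<in> edges F"
    then show "{\<iota> u, \<iota> v} \<in> (`) \<iota> ` edges F"
      using imageI[of "{u, v}" "edges F" "image \<iota>"] by simp
  next
    assume "{\<iota> u, \<iota> v} \<in> (`) \<iota> ` edges F"
    then obtain e where e: "e \<in> edges F" "\<iota> ` {u, v} = \<iota> ` e" by auto
    moreover have "{u, v} \<subseteq> verts F" using uv edge_sub by blast
    ultimately have "{u, v} = e"
      using inj_on_image_eq_iff[OF inj] edge_sub by blast
    then show "{u, v} \<in> edges F" using e by simp
  qed
  ultimately have K_iso: "graph_iso \<iota> (\<Union>(edges F), edges F) (support_graph n ?K)"
    unfolding graph_iso_def K_graph by simp
  have large: "a \<le> X e (\<iota> v)" if "e \<in> edges F" "v \<in> e" for e v
    using X(2,3)[OF that(1)] that(2) unfolding heavy_def by blast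
  have sums: "s \<le> X e (\<iota> v) + X e' (\<iota> v)"
    if "e \<in> edges F" "e' \<in> edges F" "v \<in> e \<inter> e'" for e e' v
    using large[of e v] large[of e' v] that a by auto
  have "?K \<subseteq> H" using X(1) by blast
  moreover have "s_copy_no_isolated q n s (\<Union>(edges F), edges F) ?K"
    unfolding s_copy_no_isolated_def Let_def
  proof (intro conjI exI[of _ \<iota>])
    show "?K \<subseteq> q_edges q n" using \<open>?K \<subseteq> H\<close> H by blast
    show "card ?K = card (edges (\<Union>(edges F), edges F))"
      using card_image[OF X_inj] by simp
    show "graph_iso \<iota> (\<Union>(edges F), edges F) (support_graph n ?K)" by (rule K_iso)
  qed (use sums K_the in simp)
  then have "s_copy q n s F ?K"
    by (intro s_copyI F card_F) (simp add: induced_non_isolated[OF F])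
  ultimately show ?thesis
    unfolding contains_s_copy_def by blast
qed


section \<open>Vectors with a prescribed support\<close>

text \<open>A vector supported on \<open>{u, v}\<close> is determined by its values at \<open>u\<close> and \<open>v\<close>, which
  turns counting vectors into counting pairs of values.\<close>

lemma q_edge_values:
  assumes "x \<in> q_edges q n" "supp n x = {u, v}"
  shows "(x u, x v) \<in> {1..q} \<times> {1..q}"
proof -
  have "u \<in> supp n x" "v \<in> supp n x" using assms by auto
  then show ?thesis
    using assms(1) unfolding q_edges_def supp_def by (auto simp: PiE_iff Suc_le_eq)
qed

lemma inj_on_values_of_q_edges:
  "inj_on (\<lambda>x. (x u, x v)) {x \<in> q_edges q n. supp n x = {u, v}}"
proof (rule inj_onI)
  fix x y
  assume x: "x \<in> {x \<in> q_edges q n. supp n x = {u, v}}"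
    and y: "y \<in> {x \<in> q_edges q n. supp n x = {u, v}}"
    and eq: "(x u, x v) = (y u, y v)"
  show "x = y"
  proof (rule PiE_ext)
    show "x \<in> {1..n} \<rightarrow>\<^sub>E {0..q}" "y \<in> {1..n} \<rightarrow>\<^sub>E {0..q}"
      using x y unfolding q_edges_def by auto
    show "x i = y i" if "i \<in> {1..n}" for i
    proof (cases "i \<in> {u, v}")
      case True
      then show ?thesis using eq by auto
    next
      case False
      then have "i \<notin> supp n x" "i \<notin> supp n y" using x y by auto
      then show ?thesis using that unfolding supp_def by simp
    qed
  qed
qed

lemma card_q_edges_with_values_le:
  assumes "H \<subseteq> q_edges q n" "finite B"
    and "\<And>x. x \<in> H \<Longrightarrow> supp n x = {u, v} \<Longrightarrow> (x u, x v) \<in> B"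
  shows "card {x \<in> H. supp n x = {u, v}} \<le> card B"
proof (rule card_inj_on_le)
  show "inj_on (\<lambda>x. (x u, x v)) {x \<in> H. supp n x = {u, v}}"
    by (rule inj_on_subset[OF inj_on_values_of_q_edges[of u v q n]]) (use assms(1) in auto)
qed (use assms in auto)

lemma card_q_edges_on_pair_le:
  assumes "H \<subseteq> q_edges q n" "p \<in> pairs n"
  shows "card {x \<in> H. supp n x = p} \<le> q\<^sup>2"
proof -
  obtain u v where p: "p = {u, v}"
    using assms(2) unfolding pairs_def by (auto simp: card_2_iff)
  have "card {x \<in> H. supp n x = {u, v}} \<le> card ({1..q} \<times> {1..q})"
    by (rule card_q_edges_with_values_le[OF assms(1)]) (use q_edge_values assms(1) in blast)+
  then show ?thesis using p by (simp add: power2_eq_square)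
qed

lemma card_light_q_edges_on_pair_le:
  assumes "H \<subseteq> q_edges q n" "p \<in> pairs n" "p \<notin> edges (heavy_graph n a H)" "1 \<le> a"
  shows "card {x \<in> H. supp n x = p} \<le> q\<^sup>2 - (q + 1 - a)\<^sup>2"
proof -
  obtain u v where p: "p = {u, v}"
    using assms(2) unfolding pairs_def by (auto simp: card_2_iff)
  let ?B = "{1..q} \<times> {1..q} - {a..q} \<times> {a..q}"
  have "card {x \<in> H. supp n x = {u, v}} \<le> card ?B"
  proof (rule card_q_edges_with_values_le[OF assms(1)])
    fix x assume x: "x \<in> H" "supp n x = {u, v}"
    have "\<not> heavy n a x"
      using assms(3) x p unfolding heavy_graph_def by (auto simp: image_iff)
    then have "\<not> (a \<le> x u \<and> a \<le> x v)"
      unfolding heavy_def x(2) by simp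
    then show "(x u, x v) \<in> ?B"
      using q_edge_values[of x q n u v] x assms(1) by auto
  qed simp
  also have "card ?B = q\<^sup>2 - (q + 1 - a)\<^sup>2"
    using assms(4) by (subst card_Diff_subset) (auto simp: power2_eq_square)
  finally show ?thesis using p by simp
qed


section \<open>The bound\<close>

text \<open>Every pair is charged \<open>q\<^sup>2 - m\<^sup>2\<close>, and the edges of the heavy graph a further \<open>m\<^sup>2\<close>, with
  \<open>m = q + 1 - a\<close>.\<close>

lemma card_le_heavy_graph_bound:
  assumes H: "H \<subseteq> q_edges q n" and a: "1 \<le> a"
  shows "card H \<le> (q\<^sup>2 - (q + 1 - a)\<^sup>2) * (n choose 2)
           + (q + 1 - a)\<^sup>2 * card (edges (heavy_graph n a H))"
proof -
  let ?E = "edges (heavy_graph n a H)" and ?m = "q + 1 - a"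
  have E: "?E \<subseteq> pairs n"
    using H supp_in_pairs unfolding heavy_graph_def by auto
  have m: "?m\<^sup>2 \<le> q\<^sup>2" using a by (intro power_mono) auto
  have fin: "finite H" using H finite_q_edges finite_subset by blast
  have "card H = (\<Sum>x\<in>H. 1)" by simp
  also have "\<dots> = (\<Sum>p\<in>pairs n. \<Sum>x\<in>{x \<in> H. supp n x = p}. 1)"
    by (rule sum.group[symmetric]) (use fin finite_pairs H supp_in_pairs in auto)
  also have "\<dots> \<le> (\<Sum>p\<in>pairs n. (q\<^sup>2 - ?m\<^sup>2) + (if p \<in> ?E then ?m\<^sup>2 else 0))"
  proof (rule sum_mono)
    fix p assume p: "p \<in> pairs n"
    show "(\<Sum>x\<in>{x \<in> H. supp n x = p}. 1) \<le> (q\<^sup>2 - ?m\<^sup>2) + (if p \<in> ?E then ?m\<^sup>2 else 0)"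
      using card_q_edges_on_pair_le[OF H p] card_light_q_edges_on_pair_le[OF H p _ a] m by simp
  qed
  also have "\<dots> = (q\<^sup>2 - ?m\<^sup>2) * (n choose 2) + ?m\<^sup>2 * card ?E"
  proof -
    have "pairs n \<inter> ?E = ?E" using E by blast
    then show ?thesis
      using sum.inter_restrict[OF finite_pairs, of "\<lambda>_. ?m\<^sup>2" n ?E]
      by (simp add: sum.distrib card_pairs mult.commute)
  qed
  finally show ?thesis .
qed

lemma ceiling_half_Suc: "\<lceil>(real q + 1) / 2\<rceil> = int (q div 2 + 1)"
proof (rule ceiling_unique)
  have q: "real q = 2 * real (q div 2) + real (q mod 2)"
  proof -
    have "q = 2 * (q div 2) + q mod 2" by simp
    then show ?thesis by (metis of_nat_add of_nat_mult of_nat_numeral)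
  qed
  have "real (q mod 2) \<le> 1" by simp
  then show "(real q + 1) / 2 \<le> of_int (int (q div 2 + 1))" using q by simp
  show "of_int (int (q div 2 + 1)) - 1 < (real q + 1) / 2" using q by simp
qed

theorem proposition1p9:
  fixes n q :: nat and F :: "'a ugraph" and H :: "(nat \<Rightarrow> nat) set"
  assumes "n \<ge> 1" and "q \<ge> 1"
    and "simple_graph F"
    and "H \<subseteq> q_edges q n"
    and "\<not> contains_s_copy q n (q + 1) F H"
  shows "int (card H) \<le>
      ((int q)\<^sup>2 - (int q - \<lceil>(real q + 1) / 2\<rceil> + 1)\<^sup>2) * int (n choose 2)
      + (int q - \<lceil>(real q + 1) / 2\<rceil> + 1)\<^sup>2 * int (ex_number n F)"
proof -
  let ?a = "q div 2 + 1"
  let ?m = "q + 1 - ?a"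
  let ?G = "heavy_graph n ?a H"
  have "q + 1 \<le> 2 * ?a" by simp
  then have "\<not> contains_graph ?G F"
    using contains_s_copy_of_contains_heavy_graph[OF assms(3,4), of "q + 1" ?a] assms(5) by blast
  then have "card (edges ?G) \<le> ex_number n F"
    by (intro card_edges_le_ex_number simple_heavy_graph[OF assms(4)]) (simp add: heavy_graph_def)
  then have "?m\<^sup>2 * card (edges ?G) \<le> ?m\<^sup>2 * ex_number n F"
    by (rule mult_le_mono2)
  then have "card H \<le> (q\<^sup>2 - ?m\<^sup>2) * (n choose 2) + ?m\<^sup>2 * ex_number n F"
    using card_le_heavy_graph_bound[OF assms(4), of ?a] by linarith
  then have "int (card H) \<le> int ((q\<^sup>2 - ?m\<^sup>2) * (n choose 2) + ?m\<^sup>2 * ex_number n F)"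
    by (rule of_nat_mono)
  also have "\<dots> = ((int q)\<^sup>2 - (int ?m)\<^sup>2) * int (n choose 2) + (int ?m)\<^sup>2 * int (ex_number n F)"
  proof -
    have "?m\<^sup>2 \<le> q\<^sup>2" by (intro power_mono) auto
    then show ?thesis by (simp only: of_nat_add of_nat_mult of_nat_diff of_nat_power)
  qed
  also have "int ?m = int q - \<lceil>(real q + 1) / 2\<rceil> + 1"
    unfolding ceiling_half_Suc by simp
  finally show ?thesis .
qed

end
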